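(* Let $d\ge 1$, let $f$ be a uniformly continuous probability density on $\mathbb{R}^d$, let $X_1,X_2,\dots$ be i.i.d. with density $f$, and let $\mathcal{X}_n=\{X_1,\dots,X_n\}$. Let $r=r_n>0$ be a sequence such that $r_n\to0$ and $nr_n^d/\log n\to\infty$, and put $N=n\,\omega\, r_n^d$. Then for every integer $k\ge 0$, almost surely, $$\frac1N\,\mathrm{H}^k_{r_n}(x,\mathcal{X}_n)\xrightarrow[n\to\infty]{} f(x)\quad\text{uniformly in } x\in\mathbb{R}^d .$$
   Context: $\mathsf{B}(x,r)$ is the closed Euclidean ball of center $x$ and radius $r$, and $\omega$ is the volume of the unit ball of $\mathbb{R}^d$. Discrete iterated H-indices: for $x\in\mathbb{R}^d$ and $r>0$, $\deg_r(x,\mathcal{X}_n)=\sum_{i=1}^n\mathbf{1}_{\|x-X_i\|\le r}$ (this formula is used for all $x$, including sample points). For a bounded function $\phi:\mathbb{R}^d\to\mathbb{R}$, $\mathrm{H}_{n,r}\phi(x)$ is the largest integer $h\ge 0$ such that $\#\{i : X_i\in\mathsf{B}(x,r),\ \phi(X_i)\ge h\}\ge h$. Then $\mathrm{H}_r^k(x,\mathcal{X}_n)$ is the value at $x$ of the function obtained by applying $\mathrm{H}_{n,r}$ $k$ times to $\deg_r(\cdot,\mathcal{X}_n)$ (so $k=0$ is the degree and $k=1$ is the H-index). *)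

theory Defs
  imports "HOL-Probability.Probability"
begin

text \<open>
  A sample point configuration is a sequence \<open>X\<close> of points, of which \<open>X 1, \<dots>, X n\<close> are used.
  Points are counted by index, i.e. with multiplicity.
\<close>

definition sample_deg :: "(nat \<Rightarrow> 'a::euclidean_space) \<Rightarrow> nat \<Rightarrow> real \<Rightarrow> 'a \<Rightarrow> real" where
  "sample_deg X n r x = (\<Sum>i=1..n. of_bool (norm (x - X i) \<le> r))"

text \<open>
  The maximum exists for every \<open>\<phi>\<close>: \<open>h = 0\<close> is always admissible, and any admissible \<open>h\<close> is at
  most \<open>n\<close>. The value is returned as a real number so that the operator can be iterated.
\<close>

definition H_operator ::
  "(nat \<Rightarrow> 'a::euclidean_space) \<Rightarrow> nat \<Rightarrow> real \<Rightarrow> ('a \<Rightarrow> real) \<Rightarrow> 'a \<Rightarrow> real" where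
  "H_operator X n r \<phi> x =
     real (GREATEST h::nat. card {i\<in>{1..n}. X i \<in> cball x r \<and> \<phi> (X i) \<ge> real h} \<ge> h)"

definition iterated_H_index ::
  "nat \<Rightarrow> (nat \<Rightarrow> 'a::euclidean_space) \<Rightarrow> nat \<Rightarrow> real \<Rightarrow> 'a \<Rightarrow> real" where
  "iterated_H_index k X n r = (H_operator X n r ^^ k) (sample_deg X n r)"

end

theory Submission imports Defs
begin

text \<open>
  The proof has a deterministic and a probabilistic half, joined at the case \<open>k = 0\<close>.

  Deterministic half. Write \<open>N = n \<omega> r\<^sup>d\<close> and suppose that \<open>deg / N\<close> and \<open>\<phi> / N\<close> are uniformly close
  to \<open>f\<close>. On a ball of the vanishing radius \<open>r\<close> the density is almost constant, so the ball
  around \<open>x\<close> contains about \<open>N f(x)\<close> sample points, and \<open>\<phi>\<close> is about \<open>N f(x)\<close> at all of them. The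
  largest \<open>h\<close> for which at least \<open>h\<close> of them have value at least \<open>h\<close> is therefore again about
  \<open>N f(x)\<close> (\<open>H_operator_approx\<close>). Induction on \<open>k\<close> reduces everything to the degree.

  Probabilistic half. What remains is a uniform law of large numbers for \<open>deg / N\<close>. At a single
  point \<open>u\<close> the degree is binomial with mean \<open>\<mu>\<^sub>u \<approx> N f(u)\<close>, and a Chernoff bound gives a deviation
  probability of order \<open>exp (- c N)\<close>, where \<open>N\<close> outgrows \<open>log n\<close>. The difficulty is that
  the supremum runs over the whole unbounded space, so that no finite net suffices. Two ideas
  replace the net.

  \<^item> If the ball of radius \<open>r\<close> around \<open>x\<close> contains too many points, then so do the balls of radius
    \<open>(1 + \<delta>) r\<close> around \<^emph>\<open>all\<close> \<open>u\<close> within \<open>\<delta> r\<close> of \<open>x\<close>; for too few points, use radius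
    \<open>(1 - \<delta>) r\<close>. Hence one bad point forces the set of bad \<open>u\<close> to have Lebesgue measure at least
    that of a ball of radius \<open>\<delta> r\<close>. By Markov's inequality and Fubini, the probability of this is at
    most the integral over \<open>u\<close> of the deviation probability at \<open>u\<close>, divided by that volume
    (\<open>bad_ball_improbable\<close>).

  \<^item> For this integral to be finite, the Chernoff bounds are given the additional factor \<open>\<mu>\<^sub>u\<close>
    (\<open>hits_upper_tail\<close>, \<open>ball_hits_uniform_lower\<close>). The probability that a sample point
    falls into a ball of radius \<open>\<rho>\<close> around \<open>u\<close> integrates over \<open>u\<close> to exactly the volume of such a ball
    (\<open>nn_integral_mass_cball\<close>).

  Together they bound the probability of a bad point by a constant times \<open>n exp (- c N)\<close>, which is
  eventually at most a constant times \<open>1 / n\<^sup>2\<close>; the Borel--Cantelli lemma finishes the argument.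
\<close>

section \<open>One application of the H-operator preserves the uniform limit\<close>

lemma H_operator_admissible:
  "card {i\<in>{1..n}. X i \<in> cball x r \<and> \<phi> (X i) \<ge> H_operator X n r \<phi> x} \<ge> H_operator X n r \<phi> x"
  and H_operator_greatest:
  "card {i\<in>{1..n}. X i \<in> cball x r \<and> \<phi> (X i) \<ge> real h} \<ge> h \<Longrightarrow> real h \<le> H_operator X n r \<phi> x"
proof -
  define P where "P = (\<lambda>h::nat. card {i\<in>{1..n}. X i \<in> cball x r \<and> \<phi> (X i) \<ge> real h} \<ge> h)"
  have bound: "\<And>h. P h \<Longrightarrow> h \<le> n"
  proof -
    fix h assume "P h"
    moreover have "card {i\<in>{1..n}. X i \<in> cball x r \<and> \<phi> (X i) \<ge> real h} \<le> card {1..n}"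
      by (rule card_mono) auto
    ultimately show "h \<le> n" unfolding P_def by simp
  qed
  have eq: "H_operator X n r \<phi> x = real (Greatest P)"
    unfolding H_operator_def P_def ..
  have "P 0" unfolding P_def by simp
  then have "P (Greatest P)" using bound by (rule GreatestI_nat)
  then show "card {i\<in>{1..n}. X i \<in> cball x r \<and> \<phi> (X i) \<ge> H_operator X n r \<phi> x} \<ge> H_operator X n r \<phi> x"
    unfolding eq unfolding P_def by simp
  show "real h \<le> H_operator X n r \<phi> x"
    if "card {i\<in>{1..n}. X i \<in> cball x r \<and> \<phi> (X i) \<ge> real h} \<ge> h"
  proof -
    have "P h" using that unfolding P_def .
    then show ?thesis using bound unfolding eq by (simp add: Greatest_le_nat[of P h n])
  qed
qed

lemma sample_deg_eq_card: "sample_deg X n r x = card {i\<in>{1..n}. X i \<in> cball x r}"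
  unfolding sample_deg_def by (simp add: dist_norm sum.If_cases of_bool_def Int_def)

text \<open>
  Upper bound: if the value \<open>h\<close> of the operator is positive, a single sample point in the ball with
  \<open>\<phi> \<ge> h\<close> already forces \<open>h \<le> N (f x + 2 e)\<close>. Lower bound: at every sample point in the ball
  \<open>\<phi> \<ge> N (f x - 2 e)\<close>, and there are at least that many of them, so the integer part of
  \<open>N (f x - 2 e)\<close> is admissible. Rounding loses at most \<open>1 \<le> e N\<close>, whence the factor \<open>3\<close>.
\<close>

lemma H_operator_approx:
  fixes f \<phi> :: "'a::euclidean_space \<Rightarrow> real"
  assumes N: "N > 0" and e: "1 \<le> e * N"
    and f_nonneg: "\<And>x. f x \<ge> 0"
    and osc: "\<And>x y. dist x y \<le> r \<Longrightarrow> \<bar>f x - f y\<bar> \<le> e"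
    and deg: "\<And>x. \<bar>sample_deg X n r x / N - f x\<bar> \<le> e"
    and phi: "\<And>x. \<bar>\<phi> x / N - f x\<bar> \<le> e"
  shows "\<bar>H_operator X n r \<phi> x / N - f x\<bar> \<le> 3 * e"
proof -
  have "e > 0" using N e by (smt (verit, best) mult_nonpos_nonneg)
  let ?H = "H_operator X n r \<phi> x"
  have upper: "?H \<le> N * (f x + 2 * e)"
  proof (cases "?H = 0")
    case True
    then show ?thesis using N \<open>e > 0\<close> f_nonneg[of x] by simp
  next
    case False
    then have "?H > 0" unfolding H_operator_def by simp
    then have "card {i\<in>{1..n}. X i \<in> cball x r \<and> \<phi> (X i) \<ge> ?H} \<noteq> 0"
      using H_operator_admissible[where X = X and x = x and r = r and \<phi> = \<phi> and n = n] by linarith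
    then obtain i where i: "X i \<in> cball x r" "?H \<le> \<phi> (X i)"
      by (auto simp: card_eq_0_iff)
    have "\<phi> (X i) / N \<le> f (X i) + e" using phi[of "X i"] by linarith
    also have "\<dots> \<le> f x + 2 * e" using osc[of x "X i"] i(1) by auto
    finally have "\<phi> (X i) \<le> N * (f x + 2 * e)" using N by (simp add: field_simps)
    with i(2) show ?thesis by simp
  qed
  have lower: "?H \<ge> N * (f x - 2 * e) - 1"
  proof (cases "N * (f x - 2 * e) \<le> 0")
    case True
    have "?H \<ge> 0" unfolding H_operator_def by simp
    with True show ?thesis by linarith
  next
    case False
    define h where "h = nat \<lfloor>N * (f x - 2 * e)\<rfloor>"
    have h: "real h \<le> N * (f x - 2 * e)" "real h > N * (f x - 2 * e) - 1"
      unfolding h_def using False by linarith+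
    have "real h \<le> \<phi> (X i)" if "X i \<in> cball x r" for i
    proof -
      have "f x - 2 * e \<le> f (X i) - e" using osc[of x "X i"] that by auto
      also have "\<dots> \<le> \<phi> (X i) / N" using phi[of "X i"] by linarith
      finally have "N * (f x - 2 * e) \<le> \<phi> (X i)" using N by (simp add: field_simps)
      with h show ?thesis by linarith
    qed
    then have eq: "{i\<in>{1..n}. X i \<in> cball x r \<and> \<phi> (X i) \<ge> real h} = {i\<in>{1..n}. X i \<in> cball x r}"
      by auto
    have "f x - 2 * e \<le> sample_deg X n r x / N" using deg[of x] \<open>e > 0\<close> by linarith
    then have "N * (f x - 2 * e) \<le> sample_deg X n r x" using N by (simp add: field_simps)
    with h have "real h \<le> sample_deg X n r x" by linarith
    then have "real h \<le> ?H"
      by (intro H_operator_greatest) (simp only: eq sample_deg_eq_card of_nat_le_iff)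
    with h show ?thesis by linarith
  qed
  have "?H / N \<le> f x + 2 * e" using upper N by (simp add: field_simps)
  moreover have "f x - 3 * e \<le> ?H / N" using lower N e by (simp add: field_simps)
  ultimately show ?thesis using \<open>e > 0\<close> by linarith
qed

lemma H_operator_uniform_limit:
  fixes f :: "'a::euclidean_space \<Rightarrow> real" and N r :: "nat \<Rightarrow> real"
  assumes N: "filterlim N at_top sequentially" and r: "r \<longlonglongrightarrow> 0"
    and f_nonneg: "\<And>x. f x \<ge> 0" and f_unif: "uniformly_continuous_on UNIV f"
    and deg: "uniform_limit UNIV (\<lambda>n x. sample_deg X n (r n) x / N n) f sequentially"
    and phi: "uniform_limit UNIV (\<lambda>n x. \<phi> n x / N n) f sequentially"
  shows "uniform_limit UNIV (\<lambda>n x. H_operator X n (r n) (\<phi> n) x / N n) f sequentially"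
proof (rule uniform_limitI)
  fix e0 :: real assume "e0 > 0"
  define e where "e = e0 / 4"
  have e: "e > 0" "3 * e < e0" using \<open>e0 > 0\<close> unfolding e_def by auto
  obtain d where d: "d > 0" "\<And>x y. dist x y < d \<Longrightarrow> dist (f x) (f y) < e"
    using f_unif e(1) unfolding uniformly_continuous_on_def by (metis UNIV_I)
  have "\<forall>\<^sub>F n in sequentially. r n < d" using r d(1) by (rule order_tendstoD)
  moreover have "\<forall>\<^sub>F n in sequentially. N n \<ge> 1 / e"
    using N unfolding filterlim_at_top by blast
  moreover have "\<forall>\<^sub>F n in sequentially. N n > 0"
    using N unfolding filterlim_at_top_dense by blast
  ultimately show "\<forall>\<^sub>F n in sequentially. \<forall>x\<in>UNIV. dist (H_operator X n (r n) (\<phi> n) x / N n) (f x) < e0"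
    using uniform_limitD[OF deg e(1)] uniform_limitD[OF phi e(1)]
  proof eventually_elim
    case (elim n)
    have "\<bar>H_operator X n (r n) (\<phi> n) x / N n - f x\<bar> \<le> 3 * e" for x
    proof (rule H_operator_approx)
      show "1 \<le> e * N n" using elim(2) e(1) by (simp add: field_simps)
      show "\<bar>f x - f y\<bar> \<le> e" if "dist x y \<le> r n" for x y
        using d(2)[of x y] that elim(1) by (simp add: dist_real_def)
    qed (use elim f_nonneg in \<open>auto simp: dist_real_def intro: less_imp_le\<close>)
    then show ?case using e(2) by (auto simp: dist_real_def intro: le_less_trans)
  qed
qed

lemma iterated_H_index_uniform_limit:
  fixes f :: "'a::euclidean_space \<Rightarrow> real" and N r :: "nat \<Rightarrow> real"
  assumes N: "filterlim N at_top sequentially" and r: "r \<longlonglongrightarrow> 0"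
    and f_nonneg: "\<And>x. f x \<ge> 0" and f_unif: "uniformly_continuous_on UNIV f"
    and deg: "uniform_limit UNIV (\<lambda>n x. sample_deg X n (r n) x / N n) f sequentially"
  shows "uniform_limit UNIV (\<lambda>n x. iterated_H_index k X n (r n) x / N n) f sequentially"
proof (induction k)
  case 0
  then show ?case using deg by (simp add: iterated_H_index_def)
next
  case (Suc k)
  then show ?case
    using H_operator_uniform_limit[OF N r f_nonneg f_unif deg Suc] by (simp add: iterated_H_index_def)
qed

section \<open>Chernoff bounds for the number of sample points in a set\<close>

lemma exp_le_quadratic:
  fixes l :: real
  assumes "\<bar>l\<bar> \<le> 1"
  shows "exp l \<le> 1 + l + l\<^sup>2"
proof (cases "l \<ge> 0")
  case True
  then show ?thesis using exp_bound[of l] assms by simp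
next
  case False
  have "1 - l \<le> exp (- l)" using exp_ge_add_one_self[of "- l"] by simp
  then have "exp l \<le> 1 / (1 - l)" using False
    by (simp add: exp_minus field_simps)
  also have "\<dots> \<le> 1 + l + l\<^sup>2"
  proof -
    have "(1 + l + l\<^sup>2) * (1 - l) = 1 - l ^ 3" by (simp add: algebra_simps power2_eq_square power3_eq_cube)
    moreover have "l ^ 3 \<le> 0" using False by (simp add: power3_eq_cube mult_nonneg_nonpos)
    ultimately show ?thesis using False by (simp add: pos_divide_le_eq)
  qed
  finally show ?thesis .
qed

locale iid_density_sample = prob_space M
  for M :: "'w measure" +
  fixes X :: "nat \<Rightarrow> 'w \<Rightarrow> 'a::euclidean_space" and f :: "'a \<Rightarrow> real"
  assumes density_nonneg: "\<And>x. f x \<ge> 0"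
    and density_integrable: "integrable lborel f"
    and density_integral: "(\<integral>x. f x \<partial>lborel) = 1"
    and sample_indep: "indep_vars (\<lambda>_. borel) X {1..}"
    and sample_density: "\<And>i. i \<ge> 1 \<Longrightarrow> distributed M lborel (X i) (\<lambda>x. ennreal (f x))"
begin

definition mass :: "'a set \<Rightarrow> real" where
  "mass B = (LINT x:B|lborel. f x)"

definition hits :: "'a set \<Rightarrow> nat \<Rightarrow> 'w \<Rightarrow> real" where
  "hits B n w = (\<Sum>i=1..n. indicator B (X i w))"

lemma sample_measurable [measurable]: "i \<ge> 1 \<Longrightarrow> X i \<in> borel_measurable M"
  using sample_density[of i] by (auto simp: distributed_def)

lemma density_measurable [measurable]: "f \<in> borel_measurable borel"
  using borel_measurable_integrable[OF density_integrable] by simp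

lemma set_integrable_density: "B \<in> sets borel \<Longrightarrow> set_integrable lborel B f"
  unfolding set_integrable_def using density_integrable by (intro integrable_mult_indicator) auto

lemma ennreal_mass:
  assumes "B \<in> sets borel"
  shows "ennreal (mass B) = (\<integral>\<^sup>+x. ennreal (f x) * indicator B x \<partial>lborel)"
proof -
  have "(\<integral>\<^sup>+x. ennreal (indicator B x *\<^sub>R f x) \<partial>lborel) = ennreal (mass B)"
    unfolding mass_def set_lebesgue_integral_def
    using set_integrable_density[OF assms] density_nonneg
    by (intro nn_integral_eq_integral) (auto simp: set_integrable_def)
  moreover have "(\<integral>\<^sup>+x. ennreal (indicator B x *\<^sub>R f x) \<partial>lborel) =
    (\<integral>\<^sup>+x. ennreal (f x) * indicator B x \<partial>lborel)"
    by (intro nn_integral_cong) (auto simp: indicator_def)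
  ultimately show ?thesis by simp
qed

lemma mass_nonneg: "mass B \<ge> 0"
  unfolding mass_def set_lebesgue_integral_def using density_nonneg
  by (intro Bochner_Integration.integral_nonneg) auto

lemma mass_le_1:
  assumes "B \<in> sets borel"
  shows "mass B \<le> 1"
proof -
  have "mass B \<le> (\<integral>x. f x \<partial>lborel)" unfolding mass_def set_lebesgue_integral_def
    using set_integrable_density[OF assms] density_integrable density_nonneg
    by (intro integral_mono) (auto simp: set_integrable_def indicator_def)
  then show ?thesis using density_integral by simp
qed

lemma prob_sample_in:
  assumes "i \<ge> 1" "B \<in> sets borel"
  shows "expectation (\<lambda>w. indicator B (X i w)) = mass B"
proof -
  have "emeasure M (X i -` B \<inter> space M) = ennreal (mass B)"
    using distributed_emeasure[OF sample_density[OF assms(1)], of B] ennreal_mass[OF assms(2)] assms(2)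
    by simp
  then have "prob (X i -` B \<inter> space M) = mass B"
    using mass_nonneg by (simp add: measure_def)
  moreover have "expectation (\<lambda>w. indicat_real B (X i w)) = expectation (indicator (X i -` B \<inter> space M))"
    by (intro Bochner_Integration.integral_cong) (auto simp: indicator_def)
  ultimately show ?thesis by simp
qed

lemma hits_measurable [measurable]:
  "B \<in> sets borel \<Longrightarrow> hits B n \<in> borel_measurable M"
  unfolding hits_def[abs_def] by (intro borel_measurable_sum) (auto intro!: measurable_compose[OF sample_measurable borel_measurable_indicator])

lemma hits_nonneg: "hits B n w \<ge> 0"
  unfolding hits_def by (intro sum_nonneg) auto

lemma
  assumes B: "B \<in> sets borel"
  shows hits_mgf: "expectation (\<lambda>w. exp (l * hits B n w)) = (1 + mass B * (exp l - 1)) ^ n"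
    and integrable_exp_hits: "integrable M (\<lambda>w. exp (l * hits B n w))"
proof -
  note B[measurable]
  define Y where "Y = (\<lambda>(i::nat) w. exp (l * indicator B (X i w)) :: real)"
  have exp_eq: "exp (l * hits B n w) = (\<Prod>i\<in>{1..n}. Y i w)" for w
    unfolding hits_def Y_def sum_distrib_left by (rule exp_sum) simp
  have "indep_vars (\<lambda>_. borel) (\<lambda>i w. (\<lambda>x. exp (l * indicator B x) :: real) (X i w)) {1..}"
    by (intro indep_vars_compose2[OF sample_indep]) measurable
  then have indep: "indep_vars (\<lambda>_. borel) Y {1..n}"
    unfolding Y_def by (rule indep_vars_subset) auto
  have ind: "integrable M (\<lambda>w. indicator B (X i w) :: real)" if "i \<ge> 1" for i
    using that B by (intro integrable_const_bound[of _ 1])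
      (auto intro!: measurable_compose[OF sample_measurable borel_measurable_indicator])
  have Y_eq: "Y i = (\<lambda>w. 1 + indicator B (X i w) * (exp l - 1))" for i
    unfolding Y_def by (auto simp: indicator_def)
  have Y_int: "integrable M (Y i)" if "i \<in> {1..n}" for i
    unfolding Y_eq using ind[of i] that by simp
  have Y_exp: "expectation (Y i) = 1 + mass B * (exp l - 1)" if "i \<in> {1..n}" for i
    unfolding Y_eq using ind[of i] that prob_sample_in[OF _ B, of i] by (simp add: prob_space)
  show "expectation (\<lambda>w. exp (l * hits B n w)) = (1 + mass B * (exp l - 1)) ^ n"
    unfolding exp_eq using indep_vars_lebesgue_integral[OF _ indep Y_int] Y_exp by simp
  show "integrable M (\<lambda>w. exp (l * hits B n w))"
    unfolding exp_eq using indep_vars_integrable[OF _ indep Y_int] by simp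
qed

text \<open>
  The moment generating function of a binomial variable is dominated by that of a Poisson variable
  with the same mean, which depends on \<open>n\<close> and the success probability through the mean only.
\<close>

lemma hits_mgf_le:
  assumes B: "B \<in> sets borel"
  shows "expectation (\<lambda>w. exp (l * hits B n w)) \<le> exp (real n * mass B * (exp l - 1))"
proof -
  have "mass B * (exp l - 1) \<ge> -1"
  proof -
    have "mass B * (1 - exp l) \<le> 1"
    proof (cases "l \<le> 0")
      case True
      then show ?thesis using mass_le_1[OF B] mass_nonneg[of B] by (intro mult_le_one) auto
    next
      case False
      then have "mass B * (1 - exp l) \<le> 0" using mass_nonneg[of B] by (intro mult_nonneg_nonpos) auto
      then show ?thesis by simp
    qed
    then show ?thesis by (simp add: algebra_simps)
  qed
  then have "(1 + mass B * (exp l - 1)) ^ n \<le> exp (mass B * (exp l - 1)) ^ n"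
    by (intro power_mono) (auto simp: exp_ge_add_one_self)
  then show ?thesis unfolding hits_mgf[OF B] by (simp add: exp_of_nat_mult[symmetric] mult.assoc)
qed

text \<open>
  Exponential Markov inequality at the parameter \<open>- l\<close>. Writing the bound with a free small \<open>l\<close>
  lets the same \<open>l\<close> serve all centres of balls later.
\<close>

lemma hits_lower_tail:
  assumes B: "B \<in> sets borel" and l: "0 < l" "l \<le> 1"
  shows "prob {w \<in> space M. hits B n w \<le> t} \<le>
    exp (l * (t - real n * mass B) + l\<^sup>2 * (real n * mass B))"
proof -
  let ?\<mu> = "real n * mass B"
  have "prob {w \<in> space M. exp (- l * hits B n w) \<ge> exp (- l * t)} \<le>
    expectation (\<lambda>w. exp (- l * hits B n w)) / exp (- l * t)"
    by (rule integral_Markov_inequality_measure[where A = "{}"])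
      (use integrable_exp_hits[OF B, of "- l" n] in auto)
  also have "{w \<in> space M. exp (- l * hits B n w) \<ge> exp (- l * t)} = {w \<in> space M. hits B n w \<le> t}"
    using l by auto
  also have "expectation (\<lambda>w. exp (- l * hits B n w)) / exp (- l * t) \<le>
    exp (?\<mu> * (exp (- l) - 1)) / exp (- l * t)"
    using hits_mgf_le[OF B, of "- l" n] by (intro divide_right_mono) auto
  also have "\<dots> = exp (l * t + ?\<mu> * (exp (- l) - 1))"
    by (simp add: exp_diff[symmetric] add.commute)
  also have "\<dots> \<le> exp (l * (t - ?\<mu>) + l\<^sup>2 * ?\<mu>)"
  proof -
    have "?\<mu> * (exp (- l) - 1) \<le> ?\<mu> * (- l + l\<^sup>2)"
      using exp_le_quadratic[of "- l"] l mass_nonneg[of B] by (intro mult_left_mono) auto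
    then show ?thesis by (simp add: algebra_simps)
  qed
  finally show ?thesis .
qed

text \<open>
  Applying Markov's inequality to \<open>exp (l S) - 1\<close> in place of \<open>exp (l S)\<close> gains the factor
  \<open>\<mu> = n mass B\<close>: the expectation is at most \<open>exp a - 1 \<le> a exp a\<close> with \<open>a\<close> of order \<open>\<mu>\<close>. The
  condition \<open>l t \<ge> 1\<close> makes the subtracted \<open>1\<close> harmless in the denominator. This factor is what makes
  the bound integrable over the centres of balls, most of which lie where the density is tiny.
\<close>

lemma hits_upper_tail:
  assumes B: "B \<in> sets borel" and l: "0 < l" "l \<le> 1" and t: "l * t \<ge> 1"
  shows "prob {w \<in> space M. hits B n w \<ge> t} \<le>
    4 * (real n * mass B) * exp (l * (real n * mass B - t) + l\<^sup>2 * (real n * mass B))"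
proof -
  let ?\<mu> = "real n * mass B"
  have \<mu>: "?\<mu> \<ge> 0" using mass_nonneg by simp
  have "l * t > 0" using t by simp
  \<comment> \<open>Hence the denominator \<open>exp (l * t) - 1\<close> is at least \<open>exp (l * t) / 2\<close>.\<close>
  have t2: "exp (l * t) \<ge> 2" using exp_ge_add_one_self[of "l * t"] t by linarith
  have "prob {w \<in> space M. exp (l * hits B n w) - 1 \<ge> exp (l * t) - 1} \<le>
    expectation (\<lambda>w. exp (l * hits B n w) - 1) / (exp (l * t) - 1)"
    by (rule integral_Markov_inequality_measure[where A = "{}"])
      (use integrable_exp_hits[OF B] t2 l \<open>l * t > 0\<close> hits_nonneg in auto)
  also have "{w \<in> space M. exp (l * hits B n w) - 1 \<ge> exp (l * t) - 1} = {w \<in> space M. hits B n w \<ge> t}"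
    using l by auto
  also have "expectation (\<lambda>w. exp (l * hits B n w) - 1) / (exp (l * t) - 1) \<le>
    (4 * ?\<mu> * exp (l * ?\<mu> + l\<^sup>2 * ?\<mu>) / 2) / (exp (l * t) / 2)"
  proof (rule frac_le)
    define a where "a = ?\<mu> * (exp l - 1)"
    have e: "exp l - 1 \<le> l + l\<^sup>2" using exp_le_quadratic[of l] l by simp
    have a_le: "a \<le> l * ?\<mu> + l\<^sup>2 * ?\<mu>"
      unfolding a_def using mult_left_mono[OF e \<mu>] by (simp add: algebra_simps)
    have "l\<^sup>2 \<le> 1" using l by (simp add: power_le_one)
    then have "exp l - 1 \<le> 2" using e l by linarith
    then have a_le2: "a \<le> 2 * ?\<mu>"
      unfolding a_def using mult_left_mono[OF _ \<mu>, of "exp l - 1" 2] by (simp add: algebra_simps)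
    have a0: "a \<ge> 0" unfolding a_def using \<mu> l by simp
    have "expectation (\<lambda>w. exp (l * hits B n w) - 1) \<le> exp a - 1"
      using hits_mgf_le[OF B, of l n] integrable_exp_hits[OF B] by (simp add: prob_space a_def)
    also have "\<dots> \<le> a * exp a"
    proof -
      have "(1 - a) * exp a \<le> exp (- a) * exp a"
        using exp_ge_add_one_self[of "- a"] by (intro mult_right_mono) auto
      then show ?thesis by (simp add: exp_minus algebra_simps)
    qed
    also have "\<dots> \<le> (2 * ?\<mu>) * exp (l * ?\<mu> + l\<^sup>2 * ?\<mu>)"
      using a_le a_le2 a0 by (intro mult_mono) auto
    finally show "expectation (\<lambda>w. exp (l * hits B n w) - 1) \<le> 4 * ?\<mu> * exp (l * ?\<mu> + l\<^sup>2 * ?\<mu>) / 2"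
      by simp
  qed (use mult_nonneg_nonneg[OF \<mu> exp_ge_zero] t2 in \<open>auto simp: mult.assoc\<close>)
  also have "\<dots> = 4 * ?\<mu> * exp (l * (?\<mu> - t) + l\<^sup>2 * ?\<mu>)"
    by (simp add: exp_diff exp_add algebra_simps)
  finally show ?thesis .
qed

section \<open>Sampling probabilities of balls and a union bound over the whole space\<close>

lemma
  assumes \<rho>: "\<rho> \<ge> 0" and osc: "\<And>y. dist u y \<le> \<rho> \<Longrightarrow> \<bar>f u - f y\<bar> \<le> e"
  shows mass_cball_le: "mass (cball u \<rho>) \<le> (f u + e) * (unit_ball_vol (real DIM('a)) * \<rho> ^ DIM('a))"
    and mass_cball_ge: "mass (cball u \<rho>) \<ge> (f u - e) * (unit_ball_vol (real DIM('a)) * \<rho> ^ DIM('a))"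
proof -
  have const: "set_integrable lborel (cball u \<rho>) (\<lambda>_. c)"
    "(LINT x:cball u \<rho>|lborel. c) = c * (unit_ball_vol (real DIM('a)) * \<rho> ^ DIM('a))" for c :: real
    unfolding set_integrable_def set_lebesgue_integral_def
    using emeasure_lborel_cball_finite[of u \<rho>] by (auto simp: content_cball[OF \<rho>])
  have "mass (cball u \<rho>) \<le> (LINT x:cball u \<rho>|lborel. f u + e)" unfolding mass_def
    by (intro set_integral_mono set_integrable_density const) (use osc in \<open>force simp: abs_le_iff\<close>)+
  then show "mass (cball u \<rho>) \<le> (f u + e) * (unit_ball_vol (real DIM('a)) * \<rho> ^ DIM('a))"
    unfolding const .
  have "(LINT x:cball u \<rho>|lborel. f u - e) \<le> mass (cball u \<rho>)" unfolding mass_def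
    by (intro set_integral_mono set_integrable_density const) (use osc in \<open>force simp: abs_le_iff\<close>)+
  then show "mass (cball u \<rho>) \<ge> (f u - e) * (unit_ball_vol (real DIM('a)) * \<rho> ^ DIM('a))"
    unfolding const .
qed

text \<open>
  By Fubini and the symmetry of the distance, integrating the indicator of \<open>dist u x \<le> \<rho>\<close> over \<open>u\<close>
  first gives the volume of a ball, independently of \<open>x\<close>, and the density integrates to \<open>1\<close>.
\<close>

lemma nn_integral_mass_cball:
  assumes \<rho>: "\<rho> \<ge> 0"
  shows "(\<integral>\<^sup>+u. ennreal (mass (cball u \<rho>)) \<partial>lborel) = ennreal (unit_ball_vol (real DIM('a)) * \<rho> ^ DIM('a))"
proof -
  let ?V = "unit_ball_vol (real DIM('a)) * \<rho> ^ DIM('a)"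
  let ?h = "\<lambda>u x. ennreal (f x) * (if dist u x \<le> \<rho> then 1 else 0)"
  have "(\<integral>\<^sup>+u. ennreal (mass (cball u \<rho>)) \<partial>lborel) = (\<integral>\<^sup>+u. \<integral>\<^sup>+x. ?h u x \<partial>lborel \<partial>lborel)"
    by (simp add: ennreal_mass indicator_def of_bool_def)
  also have "\<dots> = (\<integral>\<^sup>+x. \<integral>\<^sup>+u. ?h u x \<partial>lborel \<partial>lborel)"
    by (rule lborel_pair.Fubini') measurable
  also have "\<dots> = (\<integral>\<^sup>+x. ennreal (f x) * ennreal ?V \<partial>lborel)"
  proof (rule nn_integral_cong)
    fix x
    have "(\<integral>\<^sup>+u. ?h u x \<partial>lborel) = (\<integral>\<^sup>+u. ennreal (f x) * indicator (cball x \<rho>) u \<partial>lborel)"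
      by (intro nn_integral_cong) (auto simp: indicator_def dist_commute)
    also have "\<dots> = ennreal (f x) * emeasure lborel (cball x \<rho>)"
      by (rule nn_integral_cmult_indicator) simp
    finally show "(\<integral>\<^sup>+u. ?h u x \<partial>lborel) = ennreal (f x) * ennreal ?V"
      using \<rho> by (simp add: emeasure_cball)
  qed
  also have "\<dots> = (\<integral>\<^sup>+x. ennreal (f x) \<partial>lborel) * ennreal ?V"
    by (rule nn_integral_multc) measurable
  also have "(\<integral>\<^sup>+x. ennreal (f x) \<partial>lborel) = 1"
    using nn_integral_eq_integral[OF density_integrable] density_nonneg density_integral by simp
  finally show ?thesis by simp
qed

text \<open>
  This replaces the union bound over a net. Read \<open>(u, w) \<in> B\<close> as: the centre \<open>u\<close> is bad for the
  outcome \<open>w\<close>. The event that some ball of radius \<open>s\<close> consists of bad centres is a union over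
  uncountably many balls, and need not be measurable; it is covered by the event \<open>A\<close> that the
  set of bad centres has at least the volume \<open>V\<close> of such a ball. The expected volume of that set is the
  integral of the probabilities of being bad, so Markov's inequality bounds the probability of \<open>A\<close>.
\<close>

lemma bad_ball_improbable:
  assumes B: "B \<in> sets (lborel \<Otimes>\<^sub>M M)" and s: "s > 0" and \<rho>: "\<rho> \<ge> 0" and C: "C \<ge> 0"
    and small: "\<And>u. prob {w \<in> space M. (u, w) \<in> B} \<le> C * mass (cball u \<rho>)"
  shows "\<exists>A\<in>events. prob A \<le> C * (\<rho> / s) ^ DIM('a) \<and>
    (\<forall>w\<in>space M - A. \<forall>x. \<exists>u\<in>cball x s. (u, w) \<notin> B)"
proof -
  interpret P: pair_sigma_finite "lborel :: 'a measure" M ..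
  let ?v = "unit_ball_vol (real DIM('a))"
  define V where "V = ?v * s ^ DIM('a)"
  have v: "?v \<noteq> 0" using unit_ball_vol_pos[of "real DIM('a)"] by linarith
  have V: "V > 0" unfolding V_def using s by simp
  define g where "g = (\<lambda>w. emeasure lborel ((\<lambda>u. (u, w)) -` B))"
  have g [measurable]: "g \<in> borel_measurable M"
    unfolding g_def using B by (rule P.measurable_emeasure_Pair2)
  define A where "A = {w \<in> space M. 1 \<le> ennreal (1 / V) * g w}"
  have A: "A \<in> events" unfolding A_def by measurable
  have slice: "emeasure M (Pair u -` B) \<le> ennreal C * ennreal (mass (cball u \<rho>))" for u
  proof -
    have "Pair u -` B = {w \<in> space M. (u, w) \<in> B}"
      using sets.sets_into_space[OF B] by (auto simp: space_pair_measure)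
    then show ?thesis using small[of u] C mass_nonneg
      by (simp add: emeasure_eq_measure ennreal_mult[symmetric])
  qed
  have "emeasure M A \<le> ennreal (1 / V) * (\<integral>\<^sup>+w. g w * indicator (space M) w \<partial>M)"
    unfolding A_def by (rule nn_integral_Markov_inequality) auto
  also have "(\<integral>\<^sup>+w. g w * indicator (space M) w \<partial>M) = emeasure (lborel \<Otimes>\<^sub>M M) B"
    unfolding P.emeasure_pair_measure_alt2[OF B] g_def
    by (intro nn_integral_cong) auto
  also have "\<dots> = (\<integral>\<^sup>+u. emeasure M (Pair u -` B) \<partial>lborel)"
    by (rule emeasure_pair_measure_alt[OF B])
  also have "\<dots> \<le> (\<integral>\<^sup>+u. ennreal C * ennreal (mass (cball u \<rho>)) \<partial>lborel)"
    by (intro nn_integral_mono slice)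
  also have "\<dots> = ennreal C * (\<integral>\<^sup>+u. ennreal (mass (cball u \<rho>)) \<partial>lborel)"
    by (subst ennreal_mass, simp, subst ennreal_mass, simp)
      (intro nn_integral_cmult, simp add: indicator_def)
  also have "\<dots> = ennreal (C * (?v * \<rho> ^ DIM('a)))"
    using C \<rho> by (simp add: nn_integral_mass_cball ennreal_mult)
  also have "ennreal (1 / V) * \<dots> = ennreal (C * (\<rho> / s) ^ DIM('a))"
    using C \<rho> V v by (simp add: ennreal_mult[symmetric] V_def power_divide)
  finally have "prob A \<le> C * (\<rho> / s) ^ DIM('a)"
    using C \<rho> s by (simp add: emeasure_eq_measure mult_left_mono)
  moreover have "\<exists>u\<in>cball x s. (u, w) \<notin> B" if w: "w \<in> space M - A" for w x
  proof (rule ccontr)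
    assume "\<not> ?thesis"
    then have "cball x s \<subseteq> (\<lambda>u. (u, w)) -` B" by auto
    then have "emeasure lborel (cball x s) \<le> g w"
      unfolding g_def using B by (intro emeasure_mono sets_Pair2) auto
    then have "ennreal V \<le> g w" using s by (simp add: emeasure_cball V_def)
    then have "ennreal (1 / V) * ennreal V \<le> ennreal (1 / V) * g w" by (intro mult_left_mono) auto
    then have "1 \<le> ennreal (1 / V) * g w" using V by (simp add: ennreal_mult[symmetric])
    then show False using w unfolding A_def by simp
  qed
  ultimately show ?thesis using A by blast
qed

lemma hits_cball_pair_measurable [measurable]:
  "(\<lambda>z. hits (cball (fst z) \<rho>) n (snd z)) \<in> borel_measurable (lborel \<Otimes>\<^sub>M M)"
proof -
  have "(\<lambda>z. indicator (cball (fst z) \<rho>) (X i (snd z)) :: real) \<in> borel_measurable (lborel \<Otimes>\<^sub>M M)"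
    if "i \<ge> 1" for i
  proof -
    note measurable_compose[OF measurable_snd sample_measurable[OF that], measurable]
    show ?thesis unfolding indicator_def mem_cball by measurable
  qed
  then show ?thesis unfolding hits_def by (intro borel_measurable_sum) auto
qed

lemma hits_mono: "A \<subseteq> B \<Longrightarrow> hits A n w \<le> hits B n w"
  unfolding hits_def by (intro sum_mono) (auto simp: indicator_def)

end

section \<open>Uniform concentration of the number of sample points in a ball\<close>

text \<open>
  The exponent of the tail bounds when the mean is at most \<open>K N\<close> and the deviation is at least
  \<open>\<epsilon> N / 4\<close>. The parameter \<open>l = \<epsilon> / (8 K)\<close> lets the quadratic term absorb half of the linear one.
\<close>

lemma chernoff_exponent_le:
  fixes l \<epsilon> K N D \<mu> :: real
  assumes "l \<ge> 0" and "l * K = \<epsilon> / 8" and "D \<le> - (\<epsilon> / 4) * N" and "\<mu> \<le> K * N"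
  shows "l * D + l\<^sup>2 * \<mu> \<le> - (l * \<epsilon> / 8) * N"
proof -
  have "l * D \<le> l * (- (\<epsilon> / 4) * N)" using assms(1,3) by (intro mult_left_mono)
  moreover have "l * (- (\<epsilon> / 4) * N) = - 2 * (l * \<epsilon> / 8 * N)" by simp
  moreover have "l\<^sup>2 * \<mu> \<le> l\<^sup>2 * (K * N)" using assms(4) by (intro mult_left_mono) auto
  moreover have "l\<^sup>2 * (K * N) = l * (l * K) * N" by (simp add: power2_eq_square)
  then have "l\<^sup>2 * (K * N) = l * \<epsilon> / 8 * N" unfolding assms(2) by simp
  ultimately show ?thesis by simp
qed

context iid_density_sample
begin

lemma sample_deg_eq_hits: "sample_deg (\<lambda>i. X i w) n r x = hits (cball x r) n w"
  unfolding sample_deg_def hits_def by (intro sum.cong) (auto simp: indicator_def dist_norm)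

text \<open>
  Around a point with a large value, uniform continuity keeps the density large on a ball of fixed
  radius, whose probability would exceed \<open>1\<close>.
\<close>

lemma density_bounded:
  assumes "uniformly_continuous_on UNIV f"
  shows "\<exists>F\<ge>0. \<forall>x. f x \<le> F"
proof -
  obtain d where d: "d > 0" "\<And>x y. dist x y < d \<Longrightarrow> dist (f x) (f y) < 1"
    using assms unfolding uniformly_continuous_on_def by (metis UNIV_I zero_less_one)
  define V where "V = unit_ball_vol (real DIM('a)) * (d / 2) ^ DIM('a)"
  have V: "V > 0" unfolding V_def using d by simp
  have "f x \<le> 1 + 1 / V" for x
  proof -
    have "(f x - 1) * V \<le> mass (cball x (d / 2))" unfolding V_def
    proof (rule mass_cball_ge)
      show "\<bar>f x - f y\<bar> \<le> 1" if "dist x y \<le> d / 2" for y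
        using d(2)[of x y] d(1) that by (simp add: dist_real_def)
    qed (use d in auto)
    also have "\<dots> \<le> 1" by (rule mass_le_1) simp
    finally show ?thesis using V by (simp add: field_simps)
  qed
  moreover have "1 + 1 / V \<ge> 0" using V by simp
  ultimately show ?thesis by blast
qed

text \<open>
  A centre \<open>u\<close> is called bad if the ball of the enlarged radius \<open>\<rho> = (1 + \<delta>) r\<close> around it has at least
  \<open>t u = (f u + 3 \<epsilon> / 4) N\<close> points. The budget \<open>\<epsilon>\<close> is split into four: oscillation of the
  density inside the enlarged ball, growth of its volume, the gap \<open>\<epsilon> N / 4\<close> left between \<open>t u\<close> and
  the mean for the Chernoff bound, and oscillation of the density when passing from \<open>x\<close> to \<open>u\<close>.
\<close>

lemma ball_hits_uniform_upper:
  fixes n :: nat and \<epsilon> \<delta> r F N l :: real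
  defines "N \<equiv> real n * (unit_ball_vol (real DIM('a)) * r ^ DIM('a))"
    and "l \<equiv> \<epsilon> / (8 * (F + 1))"
  assumes \<epsilon>: "0 < \<epsilon>" "\<epsilon> \<le> 1" and F: "F \<ge> 0" "\<And>x. f x \<le> F" and r: "r > 0"
    and osc: "\<And>x y. dist x y \<le> 2 * r \<Longrightarrow> \<bar>f x - f y\<bar> \<le> \<epsilon> / 4"
    and \<delta>: "0 < \<delta>" "\<delta> < 1" "(1 + \<delta>) ^ DIM('a) \<le> 1 + \<epsilon> / (4 * (F + 1))"
    and large: "l * (3 / 4 * \<epsilon> * N) \<ge> 1"
  shows "\<exists>A\<in>events. prob A \<le> 4 * real n * exp (- (l * \<epsilon> / 8) * N) * (2 / \<delta>) ^ DIM('a) \<and>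
    (\<forall>w\<in>space M - A. \<forall>x. hits (cball x r) n w < (f x + \<epsilon>) * N)"
proof -
  have N: "N \<ge> 0" unfolding N_def using r by simp
  have l: "0 < l" "l \<le> 1" "l * (F + 1) = \<epsilon> / 8"
    unfolding l_def using \<epsilon> F by (auto simp: field_simps)
  define \<kappa> where "\<kappa> = \<epsilon> / (4 * (F + 1))"
  have \<kappa>: "(F + 1) * \<kappa> = \<epsilon> / 4" "\<kappa> \<ge> 0"
    unfolding \<kappa>_def using F(1) \<epsilon> by (auto simp: field_simps)
  define \<rho> where "\<rho> = (1 + \<delta>) * r"
  have \<rho>: "\<rho> > 0" "\<rho> \<le> 2 * r" "r + \<delta> * r = \<rho>" unfolding \<rho>_def using \<delta>(1,2) r by (auto simp: distrib_right intro: add_pos_pos)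
  define t where "t u = (f u + 3 / 4 * \<epsilon>) * N" for u
  define B where "B = {z \<in> space (lborel \<Otimes>\<^sub>M M). t (fst z) \<le> hits (cball (fst z) \<rho>) n (snd z)}"
  define C where "C = 4 * real n * exp (- (l * \<epsilon> / 8) * N)"
  have B: "B \<in> sets (lborel \<Otimes>\<^sub>M M)" unfolding B_def t_def by measurable
  have "prob {w \<in> space M. (u, w) \<in> B} \<le> C * mass (cball u \<rho>)" for u
  proof -
    let ?\<mu> = "real n * mass (cball u \<rho>)"
    have "?\<mu> \<le> real n * ((f u + \<epsilon> / 4) * (unit_ball_vol (real DIM('a)) * \<rho> ^ DIM('a)))"
      using \<rho> by (intro mult_left_mono mass_cball_le osc) auto
    also have "\<dots> = ((f u + \<epsilon> / 4) * (1 + \<delta>) ^ DIM('a)) * N"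
      unfolding N_def \<rho>_def by (simp add: power_mult_distrib)
    also have "\<dots> \<le> (f u + \<epsilon> / 2) * N"
    proof (rule mult_right_mono[OF _ N])
      have "(f u + \<epsilon> / 4) * (1 + \<delta>) ^ DIM('a) \<le> (f u + \<epsilon> / 4) * (1 + \<kappa>)"
        using density_nonneg[of u] \<epsilon> \<delta>(3)[folded \<kappa>_def] by (intro mult_left_mono) auto
      also have "(f u + \<epsilon> / 4) * \<kappa> \<le> (F + 1) * \<kappa>"
        using F(1) \<epsilon> F(2)[of u] \<kappa>(2) by (intro mult_right_mono) linarith+
      then have "(f u + \<epsilon> / 4) * (1 + \<kappa>) \<le> f u + \<epsilon> / 2"
        unfolding \<kappa>(1) distrib_left mult_1_right by linarith
      finally show "(f u + \<epsilon> / 4) * (1 + \<delta>) ^ DIM('a) \<le> f u + \<epsilon> / 2" .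
    qed
    finally have \<mu>1: "?\<mu> \<le> (f u + \<epsilon> / 2) * N" .
    also have "\<dots> \<le> (F + 1) * N" using F(2)[of u] \<epsilon> N by (intro mult_right_mono) auto
    finally have \<mu>2: "?\<mu> \<le> (F + 1) * N" .
    have "l * (3 / 4 * \<epsilon> * N) \<le> l * t u"
      unfolding t_def using l N density_nonneg[of u] by (intro mult_left_mono mult_right_mono) auto
    then have "l * t u \<ge> 1" using large by linarith
    then have "prob {w \<in> space M. t u \<le> hits (cball u \<rho>) n w} \<le>
        4 * ?\<mu> * exp (l * (?\<mu> - t u) + l\<^sup>2 * ?\<mu>)"
      using l by (intro hits_upper_tail) auto
    also have "\<dots> \<le> 4 * ?\<mu> * exp (- (l * \<epsilon> / 8) * N)"
    proof -
      have "?\<mu> - t u \<le> - (\<epsilon> / 4) * N" using \<mu>1 unfolding t_def by (simp add: algebra_simps)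
      from chernoff_exponent_le[OF _ l(3) this \<mu>2] l(1)
      have "l * (?\<mu> - t u) + l\<^sup>2 * ?\<mu> \<le> - (l * \<epsilon> / 8) * N" by simp
      then show ?thesis using mass_nonneg by (intro mult_left_mono) auto
    qed
    finally show ?thesis unfolding B_def C_def by (simp add: space_pair_measure mult_ac)
  qed
  moreover have "C \<ge> 0" unfolding C_def by simp
  ultimately obtain A where A: "A \<in> events" "prob A \<le> C * (\<rho> / (\<delta> * r)) ^ DIM('a)"
    "\<And>w x. w \<in> space M - A \<Longrightarrow> \<exists>u\<in>cball x (\<delta> * r). (u, w) \<notin> B"
    using bad_ball_improbable[OF B, of "\<delta> * r" \<rho> C] \<delta> r \<rho> by auto
  have "(\<rho> / (\<delta> * r)) ^ DIM('a) \<le> (2 / \<delta>) ^ DIM('a)"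
    using \<rho> \<delta> r by (intro power_mono) (auto simp: field_simps)
  then have "prob A \<le> C * (2 / \<delta>) ^ DIM('a)"
    using A(2) \<open>C \<ge> 0\<close> by (meson mult_left_mono order_trans)
  moreover have "hits (cball x r) n w < (f x + \<epsilon>) * N" if w: "w \<in> space M - A" for w x
  proof -
    obtain u where u: "u \<in> cball x (\<delta> * r)" "(u, w) \<notin> B" using A(3)[OF w] by blast
    have "\<delta> * r \<le> 2 * r" using \<delta> r by (intro mult_right_mono) auto
    then have "dist x u \<le> 2 * r" using u(1) unfolding mem_cball by (rule order_trans[rotated])
    then have fu: "\<bar>f x - f u\<bar> \<le> \<epsilon> / 4" by (rule osc)
    have "cball x r \<subseteq> cball u \<rho>"
    proof
      fix y assume "y \<in> cball x r"
      then show "y \<in> cball u \<rho>"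
        using dist_triangle[of u y x] u(1) \<rho>(3) by (simp add: dist_commute)
    qed
    then have "hits (cball x r) n w \<le> hits (cball u \<rho>) n w" by (rule hits_mono)
    also have "\<dots> < t u" using u w unfolding B_def by (simp add: space_pair_measure)
    also have "\<dots> \<le> (f x + \<epsilon>) * N" unfolding t_def using fu N by (intro mult_right_mono) linarith+
    finally show ?thesis .
  qed
  ultimately show ?thesis using A(1) unfolding C_def by blast
qed

text \<open>
  The mirror image, with the reduced radius \<open>\<rho> = (1 - \<delta>) r\<close> and the same split of \<open>\<epsilon>\<close>. Here the factor
  \<open>\<mu> = n mass (cball u \<rho>)\<close> costs nothing: a count cannot be negative, so only centres with
  \<open>f u \<ge> 3 \<epsilon> / 4\<close> can be bad, and at those \<open>4 \<mu> \<ge> \<epsilon> N \<ge> 1\<close>.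
\<close>

lemma ball_hits_uniform_lower:
  fixes n :: nat and \<epsilon> \<delta> r F N l :: real
  defines "N \<equiv> real n * (unit_ball_vol (real DIM('a)) * r ^ DIM('a))"
    and "l \<equiv> \<epsilon> / (8 * (F + 1))"
  assumes \<epsilon>: "0 < \<epsilon>" "\<epsilon> \<le> 1" and F: "F \<ge> 0" "\<And>x. f x \<le> F" and r: "r > 0"
    and osc: "\<And>x y. dist x y \<le> 2 * r \<Longrightarrow> \<bar>f x - f y\<bar> \<le> \<epsilon> / 4"
    and \<delta>: "0 < \<delta>" "\<delta> < 1" "(1 - \<delta>) ^ DIM('a) \<ge> 1 - \<epsilon> / (4 * (F + 1))"
    and large: "\<epsilon> * N \<ge> 1"
  shows "\<exists>A\<in>events. prob A \<le> 4 * real n * exp (- (l * \<epsilon> / 8) * N) * (2 / \<delta>) ^ DIM('a) \<and>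
    (\<forall>w\<in>space M - A. \<forall>x. hits (cball x r) n w > (f x - \<epsilon>) * N)"
proof -
  have N: "N \<ge> 0" unfolding N_def using r by simp
  have l: "0 < l" "l \<le> 1" "l * (F + 1) = \<epsilon> / 8"
    unfolding l_def using \<epsilon> F by (auto simp: field_simps)
  define \<kappa> where "\<kappa> = \<epsilon> / (4 * (F + 1))"
  have \<kappa>: "(F + 1) * \<kappa> = \<epsilon> / 4" "\<kappa> \<ge> 0"
    unfolding \<kappa>_def using F(1) \<epsilon> by (auto simp: field_simps)
  define \<rho> where "\<rho> = (1 - \<delta>) * r"
  have \<rho>: "\<rho> > 0" "\<rho> \<le> 2 * r" "\<rho> + \<delta> * r = r" unfolding \<rho>_def using \<delta> r by (auto simp: algebra_simps)
  define t where "t u = (f u - 3 / 4 * \<epsilon>) * N" for u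
  define B where "B = {z \<in> space (lborel \<Otimes>\<^sub>M M). hits (cball (fst z) \<rho>) n (snd z) \<le> t (fst z)}"
  define C where "C = 4 * real n * exp (- (l * \<epsilon> / 8) * N)"
  have "C \<ge> 0" unfolding C_def by simp
  have B: "B \<in> sets (lborel \<Otimes>\<^sub>M M)" unfolding B_def t_def by measurable
  have "prob {w \<in> space M. (u, w) \<in> B} \<le> C * mass (cball u \<rho>)" for u
  proof (cases "f u < 3 / 4 * \<epsilon>")
    case True
    have "N > 0" using large \<epsilon> N by (cases "N = 0") auto
    with True have "t u < 0" unfolding t_def by (simp add: mult_neg_pos)
    have "(u, w) \<notin> B" for w
      using \<open>t u < 0\<close> hits_nonneg[of "cball u \<rho>" n w] unfolding B_def by auto
    then show ?thesis using \<open>C \<ge> 0\<close> mass_nonneg by simp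
  next
    case False
    let ?\<mu> = "real n * mass (cball u \<rho>)"
    have "(f u - \<epsilon> / 2) * N \<le> ((f u - \<epsilon> / 4) * (1 - \<delta>) ^ DIM('a)) * N"
    proof (rule mult_right_mono[OF _ N])
      have "(f u - \<epsilon> / 4) * \<kappa> \<le> (F + 1) * \<kappa>"
        using F(1) \<epsilon> F(2)[of u] \<kappa>(2) by (intro mult_right_mono) linarith+
      then have "f u - \<epsilon> / 2 \<le> (f u - \<epsilon> / 4) * (1 - \<kappa>)"
        unfolding \<kappa>(1) right_diff_distrib mult_1_right by linarith
      also have "\<dots> \<le> (f u - \<epsilon> / 4) * (1 - \<delta>) ^ DIM('a)"
        using False \<epsilon> \<delta>(3)[folded \<kappa>_def] by (intro mult_left_mono) auto
      finally show "f u - \<epsilon> / 2 \<le> (f u - \<epsilon> / 4) * (1 - \<delta>) ^ DIM('a)" .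
    qed
    also have "\<dots> = real n * ((f u - \<epsilon> / 4) * (unit_ball_vol (real DIM('a)) * \<rho> ^ DIM('a)))"
      unfolding N_def \<rho>_def by (simp add: power_mult_distrib)
    also have "\<dots> \<le> ?\<mu>"
      using \<rho> by (intro mult_left_mono mass_cball_ge osc) auto
    finally have \<mu>1: "(f u - \<epsilon> / 2) * N \<le> ?\<mu>" .
    have "?\<mu> \<le> real n * ((f u + \<epsilon> / 4) * (unit_ball_vol (real DIM('a)) * \<rho> ^ DIM('a)))"
      using \<rho> by (intro mult_left_mono mass_cball_le osc) auto
    also have "\<dots> = ((f u + \<epsilon> / 4) * (1 - \<delta>) ^ DIM('a)) * N"
      unfolding N_def \<rho>_def by (simp add: power_mult_distrib)
    also have "\<dots> \<le> ((F + 1) * 1) * N"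
      using N \<delta> F(1) F(2)[of u] \<epsilon> by (intro mult_right_mono mult_mono power_le_one) auto
    finally have \<mu>2: "?\<mu> \<le> (F + 1) * N" by simp
    have "\<epsilon> / 4 * N \<le> (f u - \<epsilon> / 2) * N" using False N by (intro mult_right_mono) auto
    with \<mu>1 large have \<mu>3: "1 \<le> 4 * ?\<mu>" by linarith
    have "prob {w \<in> space M. hits (cball u \<rho>) n w \<le> t u} \<le>
        exp (l * (t u - ?\<mu>) + l\<^sup>2 * ?\<mu>)"
      using l by (intro hits_lower_tail) auto
    also have "\<dots> \<le> exp (- (l * \<epsilon> / 8) * N)"
    proof -
      have "t u - ?\<mu> \<le> - (\<epsilon> / 4) * N" using \<mu>1 unfolding t_def by (simp add: algebra_simps)
      from chernoff_exponent_le[OF _ l(3) this \<mu>2] l(1) show ?thesis by simp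
    qed
    also have "\<dots> \<le> 4 * ?\<mu> * exp (- (l * \<epsilon> / 8) * N)"
      using mult_right_mono[OF \<mu>3, of "exp (- (l * \<epsilon> / 8) * N)"] by simp
    finally show ?thesis unfolding B_def C_def by (simp add: space_pair_measure mult_ac)
  qed
  then obtain A where A: "A \<in> events" "prob A \<le> C * (\<rho> / (\<delta> * r)) ^ DIM('a)"
    "\<And>w x. w \<in> space M - A \<Longrightarrow> \<exists>u\<in>cball x (\<delta> * r). (u, w) \<notin> B"
    using bad_ball_improbable[OF B, of "\<delta> * r" \<rho> C] \<delta> r \<rho> \<open>C \<ge> 0\<close> by auto
  have "(\<rho> / (\<delta> * r)) ^ DIM('a) \<le> (2 / \<delta>) ^ DIM('a)"
    using \<rho> \<delta> r by (intro power_mono) (auto simp: field_simps)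
  then have "prob A \<le> C * (2 / \<delta>) ^ DIM('a)"
    using A(2) \<open>C \<ge> 0\<close> by (meson mult_left_mono order_trans)
  moreover have "hits (cball x r) n w > (f x - \<epsilon>) * N" if w: "w \<in> space M - A" for w x
  proof -
    obtain u where u: "u \<in> cball x (\<delta> * r)" "(u, w) \<notin> B" using A(3)[OF w] by blast
    have "\<delta> * r \<le> 2 * r" using \<delta> r by (intro mult_right_mono) auto
    then have "dist x u \<le> 2 * r" using u(1) unfolding mem_cball by (rule order_trans[rotated])
    then have fu: "\<bar>f x - f u\<bar> \<le> \<epsilon> / 4" by (rule osc)
    have "cball u \<rho> \<subseteq> cball x r"
    proof
      fix y assume "y \<in> cball u \<rho>"
      then show "y \<in> cball x r"
        using dist_triangle[of x y u] u(1) \<rho>(3) by simp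
    qed
    then have "hits (cball u \<rho>) n w \<le> hits (cball x r) n w" by (rule hits_mono)
    moreover have "t u < hits (cball u \<rho>) n w" using u w unfolding B_def by (simp add: space_pair_measure)
    moreover have "(f x - \<epsilon>) * N \<le> t u" unfolding t_def using fu N by (intro mult_right_mono) linarith+
    ultimately show ?thesis by linarith
  qed
  ultimately show ?thesis using A(1) unfolding C_def by blast
qed

section \<open>Almost sure uniform convergence\<close>

text \<open>
  For large \<open>n\<close>, with probability at least \<open>1 - b n\<close>, where \<open>b n\<close> is a multiple of \<open>n exp (- c N)\<close>, no point
  deviates by \<open>\<epsilon>\<close>. Since \<open>N / ln n\<close> tends to infinity, eventually \<open>c N \<ge> 3 ln n\<close>, so \<open>b n\<close> is summable.
\<close>

lemma sample_deg_deviation_AE: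
  fixes r :: "nat \<Rightarrow> real" and \<epsilon> :: real
  defines "N \<equiv> \<lambda>n. real n * (unit_ball_vol (real DIM('a)) * r n ^ DIM('a))"
  assumes unif: "uniformly_continuous_on UNIV f"
    and r_pos: "\<And>n. n \<ge> 1 \<Longrightarrow> r n > 0"
    and r_lim: "r \<longlonglongrightarrow> 0"
    and N_lim: "filterlim N at_top sequentially"
    and growth: "filterlim (\<lambda>n. N n / ln (real n)) at_top sequentially"
    and \<epsilon>: "0 < \<epsilon>" "\<epsilon> \<le> 1"
  shows "AE w in M. \<forall>\<^sub>F n in sequentially. \<forall>x. \<bar>sample_deg (\<lambda>i. X i w) n (r n) x / N n - f x\<bar> < \<epsilon>"
proof -
  obtain F where F: "F \<ge> 0" "\<And>x. f x \<le> F" using density_bounded[OF unif] by blast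
  define l where "l = \<epsilon> / (8 * (F + 1))"
  define \<kappa> where "\<kappa> = \<epsilon> / (4 * (F + 1))"
  have l: "l > 0" and \<kappa>: "\<kappa> > 0" unfolding l_def \<kappa>_def using \<epsilon> F by auto
  obtain \<delta> :: real where \<delta>: "0 < \<delta>" "\<delta> < 1" "(1 + \<delta>) ^ DIM('a) \<le> 1 + \<kappa>" "(1 - \<delta>) ^ DIM('a) \<ge> 1 - \<kappa>"
  proof -
    have "((\<lambda>\<delta>::real. (1 + \<delta>) ^ DIM('a)) \<longlongrightarrow> (1 + 0) ^ DIM('a)) (at_right 0)"
      "((\<lambda>\<delta>::real. (1 - \<delta>) ^ DIM('a)) \<longlongrightarrow> (1 - 0) ^ DIM('a)) (at_right 0)"
      by (intro tendsto_intros)+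
    then have "\<forall>\<^sub>F \<delta>::real in at_right 0. (1 + \<delta>) ^ DIM('a) < 1 + \<kappa>"
      "\<forall>\<^sub>F \<delta>::real in at_right 0. (1 - \<delta>) ^ DIM('a) > 1 - \<kappa>"
      using \<kappa> by (auto intro: order_tendstoD)
    moreover have "\<forall>\<^sub>F \<delta>::real in at_right 0. 0 < \<delta> \<and> \<delta> < 1"
      by (auto simp: eventually_at_right_field intro: exI[of _ 1])
    ultimately have "\<forall>\<^sub>F \<delta>::real in at_right 0. (1 + \<delta>) ^ DIM('a) < 1 + \<kappa> \<and> (1 - \<delta>) ^ DIM('a) > 1 - \<kappa> \<and> 0 < \<delta> \<and> \<delta> < 1"
      by eventually_elim simp
    then obtain \<delta> :: real where "(1 + \<delta>) ^ DIM('a) < 1 + \<kappa>" "(1 - \<delta>) ^ DIM('a) > 1 - \<kappa>" "0 < \<delta>" "\<delta> < 1"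
      using eventually_happens by force
    then show ?thesis using that[of \<delta>] by simp
  qed
  obtain d where d: "d > 0" "\<And>x y. dist x y < d \<Longrightarrow> dist (f x) (f y) < \<epsilon> / 4"
    using unif \<epsilon>(1) unfolding uniformly_continuous_on_def by (metis UNIV_I divide_pos_pos zero_less_numeral)
  define c where "c = l * \<epsilon> / 8"
  have c: "c > 0" unfolding c_def using l \<epsilon> by simp
  define b where "b n = 8 * (2 / \<delta>) ^ DIM('a) * (real n * exp (- c * N n))" for n
  define good where "good n w \<longleftrightarrow> (\<forall>x. \<bar>sample_deg (\<lambda>i. X i w) n (r n) x / N n - f x\<bar> < \<epsilon>)" for n w
  have "\<forall>\<^sub>F n in sequentially. r n < d / 2" using r_lim d(1) by (intro order_tendstoD) auto
  moreover have "\<forall>\<^sub>F n in sequentially. N n \<ge> 1 / (l * (3 / 4 * \<epsilon>))"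
    using N_lim unfolding filterlim_at_top by blast
  moreover have "\<forall>\<^sub>F n in sequentially. N n \<ge> 1 / \<epsilon>"
    using N_lim unfolding filterlim_at_top by blast
  ultimately have ev: "\<forall>\<^sub>F n in sequentially. \<exists>A\<in>events. prob A \<le> b n \<and> (\<forall>w\<in>space M - A. good n w)"
    using eventually_ge_at_top[of 1]
  proof eventually_elim
    case (elim n)
    have r: "r n > 0" using r_pos elim(4) .
    have N: "N n > 0" unfolding N_def using r elim(4) by simp
    have osc: "\<bar>f x - f y\<bar> \<le> \<epsilon> / 4" if "dist x y \<le> 2 * r n" for x y
      using d(2)[of x y] that elim(1) by (simp add: dist_real_def)
    have large: "l * (3 / 4 * \<epsilon> * N n) \<ge> 1" "\<epsilon> * N n \<ge> 1"
      using elim(2,3) l \<epsilon> by (simp_all add: field_simps)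
    obtain A1 where A1: "A1 \<in> events" "prob A1 \<le> 4 * real n * exp (- c * N n) * (2 / \<delta>) ^ DIM('a)"
      "\<And>w x. w \<in> space M - A1 \<Longrightarrow> hits (cball x (r n)) n w < (f x + \<epsilon>) * N n"
      using ball_hits_uniform_upper[OF \<epsilon> F r osc \<delta>(1,2,3)[unfolded \<kappa>_def] large(1)[unfolded l_def N_def]]
      unfolding c_def l_def N_def by blast
    obtain A2 where A2: "A2 \<in> events" "prob A2 \<le> 4 * real n * exp (- c * N n) * (2 / \<delta>) ^ DIM('a)"
      "\<And>w x. w \<in> space M - A2 \<Longrightarrow> hits (cball x (r n)) n w > (f x - \<epsilon>) * N n"
      using ball_hits_uniform_lower[OF \<epsilon> F r osc \<delta>(1,2,4)[unfolded \<kappa>_def] large(2)[unfolded N_def]]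
      unfolding c_def l_def N_def by blast
    have "prob (A1 \<union> A2) \<le> prob A1 + prob A2" using A1 A2 by (intro measure_Un_le)
    also have "\<dots> \<le> b n" unfolding b_def using A1(2) A2(2) by (simp add: mult_ac)
    finally have "prob (A1 \<union> A2) \<le> b n" .
    moreover have "good n w" if "w \<in> space M - (A1 \<union> A2)" for w
      unfolding good_def
    proof
      fix x
      have "hits (cball x (r n)) n w / N n < f x + \<epsilon>" "hits (cball x (r n)) n w / N n > f x - \<epsilon>"
        using A1(3)[of w x] A2(3)[of w x] that N by (simp_all add: field_simps)
      then show "\<bar>sample_deg (\<lambda>i. X i w) n (r n) x / N n - f x\<bar> < \<epsilon>"
        unfolding sample_deg_eq_hits by linarith
    qed
    ultimately show ?case using A1(1) A2(1) by blast
  qed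
  then obtain n0 where n0: "\<And>n. n \<ge> n0 \<Longrightarrow> \<exists>A\<in>events. prob A \<le> b n \<and> (\<forall>w\<in>space M - A. good n w)"
    unfolding eventually_sequentially by blast
  then have "\<forall>n. \<exists>A. A \<in> events \<and> (n \<ge> n0 \<longrightarrow> prob A \<le> b n \<and> (\<forall>w\<in>space M - A. good n w))"
    by (metis sets.empty_sets)
  then obtain A where A: "\<And>n. A n \<in> events" "\<And>n. n \<ge> n0 \<Longrightarrow> prob (A n) \<le> b n"
    "\<And>n w. n \<ge> n0 \<Longrightarrow> w \<in> space M - A n \<Longrightarrow> good n w"
    by metis
  have b_le: "\<forall>\<^sub>F n in sequentially. b n \<le> 8 * (2 / \<delta>) ^ DIM('a) * (1 / real n ^ 2)"
  proof -
    have "\<forall>\<^sub>F n in sequentially. N n / ln (real n) \<ge> 3 / c"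
      using growth unfolding filterlim_at_top by blast
    then show ?thesis using eventually_ge_at_top[of 2]
    proof eventually_elim
      case (elim n)
      have n: "real n > 0" "ln (real n) > 0" using elim(2) by auto
      then have "3 * ln (real n) \<le> c * N n" using elim(1) c by (simp add: field_simps)
      then have "exp (- c * N n) \<le> exp (- (3 * ln (real n)))" by simp
      also have "\<dots> = 1 / real n ^ 3"
        using n exp_of_nat_mult[of 3 "ln (real n)"] by (simp add: exp_minus inverse_eq_divide)
      finally have "real n * exp (- c * N n) \<le> real n * (1 / real n ^ 3)"
        by (intro mult_left_mono) auto
      also have "\<dots> = 1 / real n ^ 2" using n by (simp add: power2_eq_square power3_eq_cube)
      finally show ?case unfolding b_def using \<delta> by (intro mult_left_mono) auto
    qed
  qed
  have "summable (\<lambda>n. prob (A n))"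
  proof (rule summable_comparison_test_ev)
    show "\<forall>\<^sub>F n in sequentially. norm (prob (A n)) \<le> 8 * (2 / \<delta>) ^ DIM('a) * (1 / real n ^ 2)"
      using b_le eventually_ge_at_top[of n0]
      by eventually_elim (use A(2) in \<open>fastforce intro: order_trans\<close>)
    show "summable (\<lambda>n. 8 * (2 / \<delta>) ^ DIM('a) * (1 / real n ^ 2))"
      using inverse_power_summable[of 2, where 'a = real]
      by (intro summable_mult) (simp add: inverse_eq_divide)
  qed
  then have "AE w in M. \<forall>\<^sub>F n in sequentially. w \<in> space M - A n"
    using A(1) by (intro borel_cantelli_AE1) (auto simp: emeasure_eq_measure)
  then have "AE w in M. \<forall>\<^sub>F n in sequentially. good n w"
  proof eventually_elim
    case (elim w)
    then show ?case using eventually_ge_at_top[of n0] by eventually_elim (use A(3) in auto)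
  qed
  then show ?thesis unfolding good_def .
qed

lemma sample_deg_uniform_limit_AE:
  fixes r :: "nat \<Rightarrow> real"
  defines "N \<equiv> \<lambda>n. real n * (unit_ball_vol (real DIM('a)) * r n ^ DIM('a))"
  assumes unif: "uniformly_continuous_on UNIV f"
    and r_pos: "\<And>n. n \<ge> 1 \<Longrightarrow> r n > 0"
    and r_lim: "r \<longlonglongrightarrow> 0"
    and N_lim: "filterlim N at_top sequentially"
    and growth: "filterlim (\<lambda>n. N n / ln (real n)) at_top sequentially"
  shows "AE w in M. uniform_limit UNIV (\<lambda>n x. sample_deg (\<lambda>i. X i w) n (r n) x / N n) f sequentially"
proof -
  have "AE w in M. \<forall>m. \<forall>\<^sub>F n in sequentially. \<forall>x.
      \<bar>sample_deg (\<lambda>i. X i w) n (r n) x / N n - f x\<bar> < inverse (real (Suc m))"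
    unfolding AE_all_countable N_def
    by (intro allI sample_deg_deviation_AE assms[unfolded N_def]) (auto simp: inverse_eq_divide)
  then show ?thesis
  proof eventually_elim
    case (elim w)
    show ?case
    proof (rule uniform_limitI)
      fix e :: real assume "e > 0"
      then obtain m where m: "inverse (real (Suc m)) < e" using reals_Archimedean by blast
      from elim[rule_format, of m]
      show "\<forall>\<^sub>F n in sequentially. \<forall>x\<in>UNIV. dist (sample_deg (\<lambda>i. X i w) n (r n) x / N n) (f x) < e"
        by eventually_elim (use m in \<open>auto simp: dist_real_def intro: less_trans\<close>)
    qed
  qed
qed

end

theorem theorem2p6:
  fixes M :: "'w measure"
    and X :: "nat \<Rightarrow> 'w \<Rightarrow> 'a::euclidean_space"
    and f :: "'a \<Rightarrow> real"
    and r :: "nat \<Rightarrow> real"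
    and k :: nat
  assumes "prob_space M"
    and f_unif_cont: "uniformly_continuous_on UNIV f"
    and f_nonneg: "\<And>x. f x \<ge> 0"
    and f_integral: "integrable lborel f" "(\<integral>x. f x \<partial>lborel) = 1"
    and X_indep: "prob_space.indep_vars M (\<lambda>_. borel) X {1..}"
    and X_density: "\<And>i. i \<ge> 1 \<Longrightarrow> distributed M lborel (X i) (\<lambda>x. ennreal (f x))"
    and r_pos: "\<And>n. n \<ge> 1 \<Longrightarrow> r n > 0"
    and r_lim: "r \<longlonglongrightarrow> 0"
    and r_growth: "filterlim (\<lambda>n. real n * r n ^ DIM('a) / ln (real n)) at_top sequentially"
  shows "AE w in M. uniform_limit UNIV
           (\<lambda>n x. 1 / (real n * measure lborel (cball (0::'a) 1) * r n ^ DIM('a)) *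
                    iterated_H_index k (\<lambda>i. X i w) n (r n) x)
           f sequentially"
proof -
  interpret prob_space M by fact
  interpret iid_density_sample M X f
    by unfold_locales (use f_nonneg f_integral X_indep X_density in auto)
  let ?v = "unit_ball_vol (real DIM('a))"
  define N where "N = (\<lambda>n. real n * (?v * r n ^ DIM('a)))"
  have "filterlim (\<lambda>n. ?v * (real n * r n ^ DIM('a) / ln (real n))) at_top sequentially"
    by (rule filterlim_tendsto_pos_mult_at_top[OF tendsto_const _ r_growth]) simp
  then have growth: "filterlim (\<lambda>n. N n / ln (real n)) at_top sequentially"
    unfolding N_def by (simp add: mult_ac)
  have ln: "filterlim (\<lambda>n. ln (real n)) at_top sequentially"
    by (rule filterlim_compose[OF ln_at_top filterlim_real_sequentially])
  have "filterlim (\<lambda>n. N n / ln (real n) * ln (real n)) at_top sequentially"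
    by (rule filterlim_at_top_mult_at_top[OF growth ln])
  moreover have "\<forall>\<^sub>F n in sequentially. N n / ln (real n) * ln (real n) = N n"
    using eventually_ge_at_top[of 2] by eventually_elim simp
  ultimately have N_lim: "filterlim N at_top sequentially"
    using filterlim_cong[OF refl refl] by force
  have "AE w in M. uniform_limit UNIV (\<lambda>n x. sample_deg (\<lambda>i. X i w) n (r n) x / N n) f sequentially"
    unfolding N_def
    by (intro sample_deg_uniform_limit_AE f_unif_cont r_pos r_lim
        N_lim[unfolded N_def] growth[unfolded N_def])
  then show ?thesis
  proof eventually_elim
    case (elim w)
    have "uniform_limit UNIV (\<lambda>n x. iterated_H_index k (\<lambda>i. X i w) n (r n) x / N n) f sequentially"
      by (rule iterated_H_index_uniform_limit[OF N_lim r_lim f_nonneg f_unif_cont elim])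
    then show ?case
      by (simp add: N_def content_cball mult_ac)
  qed
qed

end
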